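(* The $P_2$ set $\{41,82,239\}$ cannot be extended; that is, there is no positive integer $m\notin\{41,82,239\}$ such that $\{41,82,239,m\}$ is a $P_2$ set.
   Context: Let $n$ be an integer. A set $\{a_1,\dots,a_r\}$ of $r$ distinct positive integers has the property $D(n)$, and is called a $P_n$ set of size $r$ (or a Diophantine $r$-tuple with the property $D(n)$), if $a_ia_j+n$ is a perfect square (the square of an integer) for all $1\le i<j\le r$. A $P_n$ set of size 3 cannot be extended (is non-extendable) if it cannot be enlarged to a $P_n$ set of size 4 (a Diophantine quadruple with the property $D(n)$) by adjoining a further positive integer distinct from its elements. *)

theory Defs
  imports "HOL-Computational_Algebra.Nth_Powers"
begin

text \<open>The ambient type is \<^typ>\<open>int\<close>, not \<^typ>\<open>nat\<close>, because \<open>n\<close> may be negative.\<close>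

definition P_set :: "int \<Rightarrow> nat \<Rightarrow> int set \<Rightarrow> bool" where
  "P_set n r A \<longleftrightarrow>
     finite A \<and> card A = r \<and> (\<forall>a\<in>A. a > 0) \<and>
     (\<forall>a\<in>A. \<forall>b\<in>A. a \<noteq> b \<longrightarrow> is_square (a * b + n))"

end

theory Submission
  imports Defs
begin

text \<open>
  The obstruction is the modulus 4, and it has nothing to do with the particular triple: if
  \<open>n \<equiv> 2 (mod 4)\<close>, no \<open>P\<^sub>n\<close> set has four elements. Squares are 0 or 1 modulo 4, so \<open>a b\<close> must be
  2 or 3 modulo 4. Consequently neither factor is divisible by 4, and the two factors are
  incongruent, since otherwise \<open>a b \<equiv> a\<^sup>2\<close> would be 0 or 1. The elements of a \<open>P\<^sub>n\<close> set therefore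
  lie in different nonzero residue classes, of which there are only three. The triple
  \<open>41, 82, 239\<close> occupies the classes 1, 2, 3 and leaves no room for a fourth element.
\<close>

lemma square_mod_4:
  fixes x :: int
  assumes "is_square x"
  shows "x mod 4 \<in> {0, 1}"
proof -
  obtain y where y: "x = y ^ 2"
    using assms unfolding is_nth_power_def by blast
  have "y mod 4 = 0 \<or> y mod 4 = 1 \<or> y mod 4 = 2 \<or> y mod 4 = 3" by presburger
  moreover have "x mod 4 = ((y mod 4) * (y mod 4)) mod 4"
    unfolding y power2_eq_square by (rule mod_mult_eq[symmetric])
  ultimately show ?thesis by auto
qed

lemma factors_mod_4_of_shifted_square:
  fixes a b n :: int
  assumes "n mod 4 = 2" and "is_square (a * b + n)"
  shows "a mod 4 \<noteq> 0" and "a mod 4 \<noteq> b mod 4"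
proof -
  have "(a * b + n) mod 4 = (a * b mod 4 + n mod 4) mod 4"
    by (rule mod_add_eq[symmetric])
  also have "\<dots> = ((a mod 4) * (b mod 4) mod 4 + 2) mod 4"
    by (simp only: mod_mult_eq assms(1))
  also have "\<dots> = ((a mod 4) * (b mod 4) + 2) mod 4"
    by (rule mod_add_left_eq)
  finally have sq: "((a mod 4) * (b mod 4) + 2) mod 4 \<in> {0, 1}"
    using square_mod_4[OF assms(2)] by (simp only:)
  show "a mod 4 \<noteq> 0"
  proof
    assume zero: "a mod 4 = 0"
    show False using sq unfolding zero by simp
  qed
  show "a mod 4 \<noteq> b mod 4"
  proof
    assume eq: "a mod 4 = b mod 4"
    have "b mod 4 = 0 \<or> b mod 4 = 1 \<or> b mod 4 = 2 \<or> b mod 4 = 3" by presburger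
    then show False using sq unfolding eq by (elim disjE) simp_all
  qed
qed

text \<open>Reduction modulo 4 is injective with nonzero values. That the values are nonzero needs a
  second element to multiply with, as the lone element of a singleton may be divisible by 4;
  this is why sizes up to 1 are treated apart.\<close>

lemma P_set_size_le_3:
  assumes n: "n mod 4 = 2" and P: "P_set n r A"
  shows "r \<le> 3"
proof (cases "r \<le> 1")
  case False
  have fin: "finite A" and card: "card A = r"
    and sq: "\<And>a b. a \<in> A \<Longrightarrow> b \<in> A \<Longrightarrow> a \<noteq> b \<Longrightarrow> is_square (a * b + n)"
    using P by (auto simp: P_set_def)
  have inj: "inj_on (\<lambda>a. a mod 4) A"
    using factors_mod_4_of_shifted_square(2)[OF n sq] by (auto intro: inj_onI)
  have "(\<lambda>a. a mod 4) ` A \<subseteq> {1, 2, 3}"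
  proof (rule image_subsetI)
    fix a assume a: "a \<in> A"
    have "\<not> (\<forall>x\<in>A. \<forall>y\<in>A. x = y)"
      unfolding card_le_Suc0_iff_eq[OF fin, symmetric] using False card by simp
    then obtain b where b: "b \<in> A" "a \<noteq> b" by metis
    have "a mod 4 \<noteq> 0"
      by (rule factors_mod_4_of_shifted_square(1)[OF n sq[OF a b]])
    then have "a mod 4 = 1 \<or> a mod 4 = 2 \<or> a mod 4 = 3" by presburger
    then show "a mod 4 \<in> {1, 2, 3}" by simp
  qed
  then have "card A \<le> card {1, 2, 3 :: int}"
    by (rule card_inj_on_le[OF inj]) simp
  with card show ?thesis by simp
qed simp

theorem theorem7:
  shows "P_set 2 3 {41, 82, 239} \<and>
    \<not> (\<exists>m::int. m > 0 \<and> m \<notin> {41, 82, 239} \<and> P_set 2 4 {41, 82, 239, m})"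
proof
  have "is_square (3364 :: int)" "is_square (9801 :: int)" "is_square (19600 :: int)"
    using is_nth_power_nth_power[of 2 "58 :: int"] is_nth_power_nth_power[of 2 "99 :: int"]
      is_nth_power_nth_power[of 2 "140 :: int"] by simp_all
  then show "P_set 2 3 {41, 82, 239}"
    by (simp add: P_set_def)
  show "\<not> (\<exists>m::int. m > 0 \<and> m \<notin> {41, 82, 239} \<and> P_set 2 4 {41, 82, 239, m})"
    using P_set_size_le_3[of 2 4] by auto
qed

end
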